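(* Let $(\Omega,\mathcal{H},\hat{E})$ be a sublinear expectation space as described in the context, let $p>0$, and let $\{X,X_n,n\ge1\}$ be a sequence of random variables in $\mathcal{H}$. If $X_n$ converges to $X$ in $L^p$, i.e. $\lim_{n\to\infty}\hat{E}[|X_n-X|^p]=0$, then $X_n$ converges to $X$ in capacity, i.e. for every $\varepsilon>0$, $\lim_{n\to\infty}V(\{|X_n-X|\geq\varepsilon\})=0$.
   Context: Setting. $\Omega$ is a complete separable metric space with Borel $\sigma$-algebra $\mathcal{B}(\Omega)$. $\mathcal{H}$ is a linear space of real (measurable) functions on $\Omega$ such that: every constant belongs to $\mathcal{H}$; $X\in\mathcal{H}$ implies $|X|\in\mathcal{H}$; $X_1,\dots,X_n\in\mathcal{H}$ implies $\varphi(X_1,\dots,X_n)\in\mathcal{H}$ for every $\varphi:\mathbb{R}^n\to\mathbb{R}$ satisfying $|\varphi(x)-\varphi(y)|\le C(1+|x|^m+|y|^m)|x-y|$ for all $x,y$, for some $C>0$, $m\in\mathbb{N}$ depending on $\varphi$; $I_A\in\mathcal{H}$ for all $A\in\mathcal{B}(\Omega)$; and $f(X)\in\mathcal{H}$ for every $X\in\mathcal{H}$ and every bounded continuous $f:\mathbb{R}\to\mathbb{R}$. A sublinear expectation is a functional $\hat{E}:\mathcal{H}\to\mathbb{R}$ that is monotone ($X\ge Y\Rightarrow \hat{E}[X]\ge\hat{E}[Y]$), constant preserving ($\hat{E}[c]=c$), sub-additive ($\hat{E}[X+Y]\le\hat{E}[X]+\hat{E}[Y]$) and positively homogeneous ($\hat{E}[\lambda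 X]=\lambda\hat{E}[X]$, $\lambda\ge0$). It is assumed that there is a family $\mathcal{P}$ of probability measures on $(\Omega,\mathcal{B}(\Omega))$ with $\hat{E}[X]=\sup_{P\in\mathcal{P}}E_P[X]$ for all $X\in\mathcal{H}$. The quantity $\hat{E}[|X_n-X|^p]$ is understood as given by this supremum formula. The capacity is $V(A):=\hat{E}[I_A]=\sup_{P\in\mathcal{P}}P(A)$ for $A\in\mathcal{B}(\Omega)$. *)

theory Defs
  imports "HOL-Probability.Probability"
begin

text \<open>
  The growth condition on \<open>\<phi> : \<real>\<^sup>n \<rightarrow> \<real>\<close>. As \<open>n\<close> has to be quantified inside the closure
  property of \<open>\<H>\<close> below, points of \<open>\<real>\<^sup>n\<close> are functions \<open>nat \<Rightarrow> real\<close> of which only the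
  coordinates \<open>1, \<dots>, n\<close> enter the Euclidean norms. The inequality itself then forces
  \<open>\<phi>\<close> to depend on these coordinates only.
\<close>

definition locally_Lipschitz_poly :: "nat \<Rightarrow> ((nat \<Rightarrow> real) \<Rightarrow> real) \<Rightarrow> bool" where
  "locally_Lipschitz_poly n \<phi> \<longleftrightarrow>
    (\<exists>C>0. \<exists>m::nat. \<forall>x y.
      \<bar>\<phi> x - \<phi> y\<bar> \<le>
        C * (1 + L2_set x {1..n} ^ m + L2_set y {1..n} ^ m) * L2_set (\<lambda>i. x i - y i) {1..n})"

locale sublinear_expectation_space =
  fixes \<H> :: "('a::polish_space \<Rightarrow> real) set"
    and E :: "('a \<Rightarrow> real) \<Rightarrow> real"
    and \<P> :: "'a measure set"
  assumes H_measurable: "X \<in> \<H> \<Longrightarrow> X \<in> borel_measurable borel"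
    and add_closed: "X \<in> \<H> \<Longrightarrow> Y \<in> \<H> \<Longrightarrow> (\<lambda>\<omega>. X \<omega> + Y \<omega>) \<in> \<H>"
    and scale_closed: "X \<in> \<H> \<Longrightarrow> (\<lambda>\<omega>. a * X \<omega>) \<in> \<H>"
    and const_closed: "(\<lambda>\<omega>. c) \<in> \<H>"
    and abs_closed: "X \<in> \<H> \<Longrightarrow> (\<lambda>\<omega>. \<bar>X \<omega>\<bar>) \<in> \<H>"
    and Lipschitz_closed:
      "n \<ge> 1 \<Longrightarrow> (\<And>i. i \<in> {1..n} \<Longrightarrow> Z i \<in> \<H>) \<Longrightarrow> locally_Lipschitz_poly n \<phi> \<Longrightarrow>
        (\<lambda>\<omega>. \<phi> (\<lambda>i. Z i \<omega>)) \<in> \<H>"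
    and indicator_closed: "A \<in> sets borel \<Longrightarrow> indicat_real A \<in> \<H>"
    and bounded_continuous_closed:
      "X \<in> \<H> \<Longrightarrow> continuous_on UNIV f \<Longrightarrow> bounded (range f) \<Longrightarrow> (\<lambda>\<omega>. f (X \<omega>)) \<in> \<H>"
    and E_mono: "X \<in> \<H> \<Longrightarrow> Y \<in> \<H> \<Longrightarrow> (\<And>\<omega>. X \<omega> \<ge> Y \<omega>) \<Longrightarrow> E X \<ge> E Y"
    and E_const: "E (\<lambda>\<omega>. c) = c"
    and E_subadditive: "X \<in> \<H> \<Longrightarrow> Y \<in> \<H> \<Longrightarrow> E (\<lambda>\<omega>. X \<omega> + Y \<omega>) \<le> E X + E Y"
    and E_pos_homogeneous: "X \<in> \<H> \<Longrightarrow> a \<ge> 0 \<Longrightarrow> E (\<lambda>\<omega>. a * X \<omega>) = a * E X"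
    and P_prob_space: "P \<in> \<P> \<Longrightarrow> prob_space P"
    and P_sets: "P \<in> \<P> \<Longrightarrow> sets P = sets borel"
    and P_integrable: "P \<in> \<P> \<Longrightarrow> X \<in> \<H> \<Longrightarrow> integrable P X"
      \<comment> \<open>Without this the Bochner integral below would silently be 0. Since \<open>\<bar>X\<bar> \<in> \<H>\<close> and
          \<open>E\<close> is real-valued, it is part of the representation of \<open>E\<close> as a supremum.\<close>
    and representation: "X \<in> \<H> \<Longrightarrow> ereal (E X) = (SUP P\<in>\<P>. ereal (\<integral>\<omega>. X \<omega> \<partial>P))"
      \<comment> \<open>The supremum is taken in \<open>ereal\<close>, so that it is the true supremum.\<close>

definition capacity :: "(('a \<Rightarrow> real) \<Rightarrow> real) \<Rightarrow> 'a set \<Rightarrow> real" where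
  "capacity E A = E (indicat_real A)"

text \<open>
  The supremum formula for nonnegative measurable \<open>Y\<close> that need not lie in \<open>\<H>\<close>
  (such as \<open>\<bar>X\<^sub>n - X\<bar>\<^sup>p\<close> with \<open>p < 1\<close>); the value may be infinite.
\<close>

definition upper_expectation :: "'a measure set \<Rightarrow> ('a \<Rightarrow> real) \<Rightarrow> ennreal" where
  "upper_expectation \<P> Y = (SUP P\<in>\<P>. \<integral>\<^sup>+\<omega>. ennreal (Y \<omega>) \<partial>P)"

definition converges_in_Lp ::
    "'a measure set \<Rightarrow> real \<Rightarrow> (nat \<Rightarrow> 'a \<Rightarrow> real) \<Rightarrow> ('a \<Rightarrow> real) \<Rightarrow> bool" where
  "converges_in_Lp \<P> p Xs X \<longleftrightarrow>
    (\<lambda>n. upper_expectation \<P> (\<lambda>\<omega>. \<bar>Xs n \<omega> - X \<omega>\<bar> powr p)) \<longlonglongrightarrow> 0"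

definition converges_in_capacity ::
    "(('a \<Rightarrow> real) \<Rightarrow> real) \<Rightarrow> (nat \<Rightarrow> 'a \<Rightarrow> real) \<Rightarrow> ('a \<Rightarrow> real) \<Rightarrow> bool" where
  "converges_in_capacity E Xs X \<longleftrightarrow>
    (\<forall>\<epsilon>>0. (\<lambda>n. capacity E {\<omega>. \<bar>Xs n \<omega> - X \<omega>\<bar> \<ge> \<epsilon>}) \<longlonglongrightarrow> 0)"

context sublinear_expectation_space
begin

lemma upper_expectation_eq:
  assumes Y: "Y \<in> \<H>" and nonneg: "\<And>\<omega>. Y \<omega> \<ge> 0"
  shows "upper_expectation \<P> Y = ennreal (E Y)"
proof -
  have eq: "upper_expectation \<P> Y = (SUP P\<in>\<P>. ennreal (\<integral>\<omega>. Y \<omega> \<partial>P))"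
    unfolding upper_expectation_def
    by (intro SUP_cong refl nn_integral_eq_integral) (use assms P_integrable in auto)
  have le: "(\<integral>\<omega>. Y \<omega> \<partial>P) \<le> E Y" if "P \<in> \<P>" for P
    using SUP_upper[OF that, of "\<lambda>P. ereal (\<integral>\<omega>. Y \<omega> \<partial>P)"] by (simp flip: representation[OF Y])
  have "ennreal (E Y) \<le> (SUP P\<in>\<P>. ennreal (\<integral>\<omega>. Y \<omega> \<partial>P))"
  proof (cases "SUP P\<in>\<P>. ennreal (\<integral>\<omega>. Y \<omega> \<partial>P)")
    case (real r)
    have "(\<integral>\<omega>. Y \<omega> \<partial>P) \<le> r" if "P \<in> \<P>" for P
      using SUP_upper[OF that, of "\<lambda>P. ennreal (\<integral>\<omega>. Y \<omega> \<partial>P)"] real by simp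
    then have "ereal (E Y) \<le> ereal r"
      unfolding representation[OF Y] by (intro SUP_least) simp
    then show ?thesis
      unfolding real(2) by (intro ennreal_leI) simp
  next
    case top
    show ?thesis
      unfolding top by simp
  qed
  moreover have "(SUP P\<in>\<P>. ennreal (\<integral>\<omega>. Y \<omega> \<partial>P)) \<le> ennreal (E Y)"
    by (intro SUP_least ennreal_leI le)
  ultimately show ?thesis
    unfolding eq by (rule antisym[rotated])
qed

lemma capacity_eq:
  assumes "A \<in> sets borel"
  shows "ereal (capacity E A) = (SUP P\<in>\<P>. ereal (measure P A))"
proof -
  have "ereal (capacity E A) = (SUP P\<in>\<P>. ereal (\<integral>\<omega>. indicat_real A \<omega> \<partial>P))"
    unfolding capacity_def using assms by (intro representation indicator_closed)
  also have "\<dots> = (SUP P\<in>\<P>. ereal (measure P A))"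
    by (intro SUP_cong refl) (use assms P_sets in \<open>simp add: sets_eq_imp_space_eq\<close>)
  finally show ?thesis .
qed

end

end

theory Submission imports Defs begin

text \<open>Markov's inequality holds under each P in \<open>\<P>\<close> with the same factor 1 /
  \<epsilon>^p. Taking suprema over P turns it into a bound of the capacity by the upper
  expectation, \<open>capacity_Markov_inequality\<close>. Applied to the differences
  \<open>Xs n - X\<close>, it squeezes the capacities between 0 and a constant multiple of a null
  sequence.\<close>

context sublinear_expectation_space
begin

lemma capacity_nonneg:
  assumes "A \<in> sets borel"
  shows "0 \<le> capacity E A"
  using E_mono[OF indicator_closed[OF assms] const_closed[of 0]] E_const[of 0]
  by (simp add: capacity_def)

text \<open>Integrate the pointwise bound of the indicator by (|Y| / \<epsilon>)^p under each P. The
  inequality lives in \<open>ennreal\<close>, as |Y|^p may lie outside \<open>\<H>\<close> and its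
  upper expectation may be infinite.\<close>

lemma capacity_Markov_inequality:
  assumes Y: "Y \<in> borel_measurable borel" and "\<epsilon> > 0" and "p > 0"
  shows "ennreal (capacity E {\<omega>. \<bar>Y \<omega>\<bar> \<ge> \<epsilon>})
           \<le> ennreal (1 / \<epsilon> powr p) * upper_expectation \<P> (\<lambda>\<omega>. \<bar>Y \<omega>\<bar> powr p)"
proof -
  let ?A = "{\<omega>. \<bar>Y \<omega>\<bar> \<ge> \<epsilon>}"
  have A: "?A \<in> sets borel"
    using Y by measurable
  have pointwise: "indicat_real ?A \<omega> \<le> 1 / \<epsilon> powr p * \<bar>Y \<omega>\<bar> powr p" for \<omega>
    using assms powr_mono2[of p \<epsilon> "\<bar>Y \<omega>\<bar>"] by (auto simp: indicator_def field_simps)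
  \<comment> \<open>Indicators of Borel sets lie in \<open>\<H>\<close>, so \<open>E\<close> can be
    traded for the supremum over \<open>\<P>\<close>.\<close>
  have "ennreal (capacity E ?A) = upper_expectation \<P> (indicat_real ?A)"
    unfolding capacity_def by (simp add: upper_expectation_eq indicator_closed[OF A])
  also have "\<dots> \<le> ennreal (1 / \<epsilon> powr p) * upper_expectation \<P> (\<lambda>\<omega>. \<bar>Y \<omega>\<bar> powr p)"
    \<comment> \<open>Only the left supremum is opened: the right side, kept whole, is a bound
      independent of P.\<close>
    unfolding upper_expectation_def[of _ "indicat_real ?A"]
  proof (rule SUP_least)
    fix P assume P: "P \<in> \<P>"
    have Y_P: "Y \<in> borel_measurable P"
      using Y P_sets[OF P] by (simp cong: measurable_cong_sets)
    have "(\<integral>\<^sup>+\<omega>. ennreal (indicat_real ?A \<omega>) \<partial>P)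
            \<le> (\<integral>\<^sup>+\<omega>. ennreal (1 / \<epsilon> powr p) * ennreal (\<bar>Y \<omega>\<bar> powr p) \<partial>P)"
      using pointwise by (intro nn_integral_mono) (simp add: ennreal_leI flip: ennreal_mult)
    also have "\<dots> = ennreal (1 / \<epsilon> powr p) * (\<integral>\<^sup>+\<omega>. ennreal (\<bar>Y \<omega>\<bar> powr p) \<partial>P)"
      using Y_P by (intro nn_integral_cmult) measurable
    also have "\<dots> \<le> ennreal (1 / \<epsilon> powr p) * upper_expectation \<P> (\<lambda>\<omega>. \<bar>Y \<omega>\<bar> powr p)"
      unfolding upper_expectation_def using P by (intro mult_left_mono SUP_upper) auto
    finally show "(\<integral>\<^sup>+\<omega>. ennreal (indicat_real ?A \<omega>) \<partial>P)
        \<le> ennreal (1 / \<epsilon> powr p) * upper_expectation \<P> (\<lambda>\<omega>. \<bar>Y \<omega>\<bar> powr p)" .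
  qed
  finally show ?thesis .
qed

end

theorem mainTheorem2:
  fixes \<H> :: "('a::polish_space \<Rightarrow> real) set"
    and E :: "('a \<Rightarrow> real) \<Rightarrow> real"
    and \<P> :: "'a measure set"
    and p :: real
    and Xs :: "nat \<Rightarrow> 'a \<Rightarrow> real"
    and X :: "'a \<Rightarrow> real"
  assumes "sublinear_expectation_space \<H> E \<P>"
    and "p > 0"
    and "X \<in> \<H>"
    and "\<And>n. n \<ge> 1 \<Longrightarrow> Xs n \<in> \<H>"
    and "converges_in_Lp \<P> p Xs X"
  shows "converges_in_capacity E Xs X"
proof -
  interpret sublinear_expectation_space \<H> E \<P> by fact
  show ?thesis
    unfolding converges_in_capacity_def
  proof (intro allI impI)
    fix \<epsilon> :: real assume "\<epsilon> > 0"
    let ?A = "\<lambda>n. {\<omega>. \<bar>Xs n \<omega> - X \<omega>\<bar> \<ge> \<epsilon>}"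
    let ?U = "\<lambda>n. ennreal (1 / \<epsilon> powr p) * upper_expectation \<P> (\<lambda>\<omega>. \<bar>Xs n \<omega> - X \<omega>\<bar> powr p)"
    \<comment> \<open>\<open>Xs 0\<close> is unconstrained, so measurability, and all that rests on
      it, is available only from index 1 on.\<close>
    have diff: "(\<lambda>\<omega>. Xs n \<omega> - X \<omega>) \<in> borel_measurable borel" if "n \<ge> 1" for n
      using assms(3) assms(4)[OF that] by (intro borel_measurable_diff H_measurable)
    have A: "?A n \<in> sets borel" if "n \<ge> 1" for n
      using diff[OF that] by measurable
    \<comment> \<open>Multiplication by a constant preserves this limit because the constant is
      finite.\<close>
    have "?U \<longlonglongrightarrow> ennreal (1 / \<epsilon> powr p) * 0"
      using assms(5) unfolding converges_in_Lp_def by (intro ennreal_tendsto_cmult) auto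
    then have U: "?U \<longlonglongrightarrow> 0" by simp
    have "(\<lambda>n. ennreal (capacity E (?A n))) \<longlonglongrightarrow> ennreal 0"
      unfolding ennreal_0
    proof (rule tendsto_sandwich[OF _ _ tendsto_const U])
      show "\<forall>\<^sub>F n in sequentially. ennreal (capacity E (?A n)) \<le> ?U n"
        using eventually_ge_at_top[of 1]
        by eventually_elim (intro capacity_Markov_inequality diff \<open>\<epsilon> > 0\<close> assms(2))
    qed simp
    \<comment> \<open>\<open>ennreal\<close> sends negative reals to 0, so returning to real limits
      requires the capacities to be eventually nonnegative.\<close>
    then show "(\<lambda>n. capacity E (?A n)) \<longlonglongrightarrow> 0"
      by (rule tendsto_ennrealD)
        (use A in \<open>auto intro!: eventually_sequentiallyI[of 1] capacity_nonneg\<close>)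
  qed
qed

end
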